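(* Let $k\ge 1$, $0\le \ell\le k-1$ and $r\ge 0$ be integers. The number $\tilde{\mathcal P}_{r,k,\ell}$ of $k$-paths of length $n=kr+2\ell$ such that (i) each internal $(u,h)$-segment has length equal to a multiple of $k$, and (ii) the first $(u,h)$-segment has length $\equiv \ell \pmod k$, is $$\tilde{\mathcal P}_{r,k,\ell}=\sum_{p=0}^{\lfloor r/2\rfloor}\frac{\ell+1}{kp+\ell+1}\binom{(k+1)p+\ell}{p}\binom{r+2(k-1)p+2\ell}{r-2p}.$$
   Context: For $k\ge1$, a $k$-path of length $n$ is a lattice path from $(0,0)$ to $(n,0)$ with steps $u=(1,1)$, $d=(1,-1)$, $h=(k,0)$ that never goes below the $x$-axis. A $(u,h)$-segment of a $k$-path is a maximal segment of consecutive steps composed of up-steps $u$ and horizontal-steps $h$; its length is its horizontal extent, i.e. each $u$ contributes $1$ and each $h$ contributes $k$. An internal $(u,h)$-segment is a $(u,h)$-segment between two down-steps. The first $(u,h)$-segment is the one with which the path begins (for the empty path it is taken to be empty, of length $0$). *)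

theory Defs
  imports Complex_Main "HOL-Library.Product_Plus" "HOL-Number_Theory.Cong"
begin

datatype step = U | D | H

fun step_vec :: "nat \<Rightarrow> step \<Rightarrow> int \<times> int" where
  "step_vec k U = (1, 1)"
| "step_vec k D = (1, - 1)"
| "step_vec k H = (int k, 0)"

text \<open>A lattice path is the list of its steps; \<open>displacement k w\<close> is the sum of the
  step vectors of \<open>w\<close>, so its first component is the horizontal extent of \<open>w\<close>.\<close>

definition displacement :: "nat \<Rightarrow> step list \<Rightarrow> int \<times> int" where
  "displacement k w = sum_list (map (step_vec k) w)"

definition horizontal_extent :: "nat \<Rightarrow> step list \<Rightarrow> int" where
  "horizontal_extent k w = fst (displacement k w)"

text \<open>Steps are straight, so not going below the axis is a condition on the lattice points
  visited, which are the displacements of the prefixes.\<close>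

definition k_path :: "nat \<Rightarrow> nat \<Rightarrow> step list \<Rightarrow> bool" where
  "k_path k n w \<longleftrightarrow>
     displacement k w = (int n, 0) \<and>
     (\<forall>i\<le>length w. snd (displacement k (take i w)) \<ge> 0)"

text \<open>\<open>uh_segment xs s ys\<close> says that the occurrence of \<open>s\<close> after \<open>xs\<close> in the path
  \<open>xs @ s @ ys\<close> is a \<open>(u,h)\<close>-segment. Maximality means that each neighbouring step, if there
  is one, is a down-step.\<close>

definition uh_segment :: "step list \<Rightarrow> step list \<Rightarrow> step list \<Rightarrow> bool" where
  "uh_segment xs s ys \<longleftrightarrow>
     s \<noteq> [] \<and> set s \<subseteq> {U, H} \<and>
     (xs = [] \<or> last xs = D) \<and> (ys = [] \<or> hd ys = D)"

definition internal_uh_segment :: "step list \<Rightarrow> step list \<Rightarrow> step list \<Rightarrow> bool" where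
  "internal_uh_segment xs s ys \<longleftrightarrow>
     uh_segment xs s ys \<and> xs \<noteq> [] \<and> last xs = D \<and> ys \<noteq> [] \<and> hd ys = D"

definition first_uh_segment :: "step list \<Rightarrow> step list" where
  "first_uh_segment w = takeWhile (\<lambda>s. s \<noteq> D) w"

definition restricted_k_paths :: "nat \<Rightarrow> nat \<Rightarrow> nat \<Rightarrow> step list set" where
  "restricted_k_paths r k l =
     {w. k_path k (k * r + 2 * l) w \<and>
         (\<forall>xs s ys. w = xs @ s @ ys \<and> internal_uh_segment xs s ys
            \<longrightarrow> int k dvd horizontal_extent k s) \<and>
         [horizontal_extent k (first_uh_segment w) = int l] (mod int k)}"

text \<open>A nonempty \<open>k\<close>-path cannot begin with a down-step, so the longest prefix free of
  down-steps is a genuine (nonempty, maximal) segment.\<close>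

lemma uh_segment_first_uh_segment:
  assumes "k_path k n w" and "w \<noteq> []"
  shows "uh_segment [] (first_uh_segment w) (dropWhile (\<lambda>s. s \<noteq> D) w)"
proof -
  obtain s w' where w: "w = s # w'"
    using assms(2) by (cases w) auto
  have "snd (displacement k (take 1 w)) \<ge> 0"
  proof -
    have "1 \<le> length w"
      by (simp add: w)
    then show ?thesis
      using assms(1) unfolding k_path_def by blast
  qed
  then have "s \<noteq> D"
    by (auto simp: w displacement_def)
  then have "takeWhile (\<lambda>s. s \<noteq> D) w \<noteq> []"
    by (simp add: w)
  moreover have "set (takeWhile (\<lambda>s. s \<noteq> D) w) \<subseteq> {U, H}"
  proof
    fix t assume "t \<in> set (takeWhile (\<lambda>s. s \<noteq> D) w)"
    then have "t \<noteq> D"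
      by (blast dest: set_takeWhileD)
    then show "t \<in> {U, H}"
      by (cases t) simp_all
  qed
  moreover have "dropWhile (\<lambda>s. s \<noteq> D) w = [] \<or> hd (dropWhile (\<lambda>s. s \<noteq> D) w) = D"
    using hd_dropWhile[of "\<lambda>s. s \<noteq> D" w] by blast
  ultimately show ?thesis
    unfolding uh_segment_def first_uh_segment_def by blast
qed

end

theory Submission
  imports Defs
begin

text \<open>The final \<open>(u,h)\<close>-segment ends at height \<open>0\<close>, so it contains no up-step, and hence the
  restrictions say that the numbers of up-steps in the successive segments are
  \<open>l, 0, \<dots>, 0\<close> modulo \<open>k\<close>. Deleting the horizontal steps leaves a path which consists of
  \<open>u\<^sup>l\<close> followed by \<open>p\<close> blocks \<open>u\<^sup>k\<close> and \<open>k p + l\<close> down-steps; counting by the first block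
  or down-step gives a Pascal type recurrence solved by the ballot numbers. The \<open>r - 2 p\<close>
  horizontal steps can be shuffled arbitrarily into such a path.\<close>

section \<open>Restricted paths as recursive predicates\<close>

text \<open>The first argument is the current height, kept general so that induction over the steps
  goes through. The guard \<open>h > 0\<close> keeps the truncated subtraction honest, and the empty
  word forces the path to end on the axis.\<close>

fun nonneg_path :: "nat \<Rightarrow> step list \<Rightarrow> bool" where
  "nonneg_path h [] \<longleftrightarrow> h = 0"
| "nonneg_path h (U # w) \<longleftrightarrow> nonneg_path (Suc h) w"
| "nonneg_path h (D # w) \<longleftrightarrow> h > 0 \<and> nonneg_path (h - 1) w"
| "nonneg_path h (H # w) \<longleftrightarrow> nonneg_path h w"

text \<open>The argument \<open>c\<close> is the number of up-steps, modulo \<open>k\<close>, already read in the current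
  segment; an offset of \<open>- l\<close> at the start encodes the condition on the first segment.\<close>

fun segments_ok :: "nat \<Rightarrow> int \<Rightarrow> step list \<Rightarrow> bool" where
  "segments_ok k c [] \<longleftrightarrow> int k dvd c"
| "segments_ok k c (U # w) \<longleftrightarrow> segments_ok k (c + 1) w"
| "segments_ok k c (D # w) \<longleftrightarrow> int k dvd c \<and> segments_ok k 0 w"
| "segments_ok k c (H # w) \<longleftrightarrow> segments_ok k c w"

section \<open>Translation of the geometric conditions\<close>

lemma displacement_Nil [simp]: "displacement k [] = 0"
  and displacement_Cons [simp]: "displacement k (s # w) = step_vec k s + displacement k w"
  by (simp_all add: displacement_def)

lemma horizontal_extent_Nil [simp]: "horizontal_extent k [] = 0"
  and horizontal_extent_Cons [simp]:
    "horizontal_extent k (s # w) = fst (step_vec k s) + horizontal_extent k w"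
  by (simp_all add: horizontal_extent_def)

lemma horizontal_extent_eq_count:
  "horizontal_extent k w =
     int (count_list w U) + int (count_list w D) + int k * int (count_list w H)"
proof (induction w)
  case (Cons s w)
  then show ?case by (cases s) (simp_all add: algebra_simps)
qed simp

lemma all_le_length_Cons:
  "(\<forall>i\<le>length (x # xs). P (take i (x # xs))) \<longleftrightarrow> P [] \<and> (\<forall>i\<le>length xs. P (x # take i xs))"
  using All_less_Suc2[of "Suc (length xs)" "\<lambda>i. P (take i (x # xs))"]
  by (simp add: less_Suc_eq_le)

text \<open>The parameter \<open>k\<close> occurs only on the right: heights ignore the width of a
  horizontal step, so one predicate serves every \<open>k\<close>.\<close>

lemma nonneg_path_iff:
  "nonneg_path h w \<longleftrightarrow> int h + snd (displacement k w) = 0 \<and>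
     (\<forall>i\<le>length w. int h + snd (displacement k (take i w)) \<ge> 0)"
proof (induction w arbitrary: h)
  case (Cons s w)
  have prefixes: "(\<forall>i\<le>length (s # w). int h + snd (displacement k (take i (s # w))) \<ge> 0) \<longleftrightarrow>
      (\<forall>i\<le>length w. int h + snd (step_vec k s) + snd (displacement k (take i w)) \<ge> 0)"
    by (subst all_le_length_Cons) (simp add: add.assoc)
  show ?case
  proof (cases s)
    case D
    show ?thesis
    proof (cases h)
      case 0
      \<comment> \<open>The empty prefix of \<open>w\<close> already violates the bound: the
        down-step from height 0 lands at -1.\<close>
      have "\<not> (\<forall>i\<le>length w. int h + snd (step_vec k s) + snd (displacement k (take i w)) \<ge> 0)"
        by (auto simp: 0 D intro!: exI[of _ 0])
      then show ?thesis unfolding prefixes by (simp add: 0 D)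
    next
      case (Suc h')
      show ?thesis unfolding prefixes by (simp add: D Suc Cons.IH)
    qed
  qed (unfold prefixes, simp_all add: Cons.IH algebra_simps)
qed simp

lemma k_path_iff:
  "k_path k n w \<longleftrightarrow> nonneg_path 0 w \<and> horizontal_extent k w = int n"
  unfolding k_path_def nonneg_path_iff[of 0 w k] horizontal_extent_def by (auto simp: prod_eq_iff)

lemma nonneg_path_count: "nonneg_path h w \<Longrightarrow> h + count_list w U = count_list w D"
  by (induction h w rule: nonneg_path.induct) auto

lemma nonneg_path_suffix: "nonneg_path h (xs @ s) \<Longrightarrow> \<exists>h'. nonneg_path h' s"
proof (induction xs arbitrary: h)
  case (Cons x xs)
  then show ?case by (cases x) auto
qed auto

text \<open>From some height h' the suffix \<open>s\<close> descends to 0 without down-steps, so h'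
  plus its number of up-steps is 0.\<close>

lemma nonneg_path_last_segment:
  assumes "nonneg_path h (xs @ s)" and "D \<notin> set s"
  shows "U \<notin> set s"
  using assms nonneg_path_suffix nonneg_path_count
  by (metis add_is_0 count_list_0_iff)

text \<open>Cutting at the first down-step is the only such decomposition, so a quantifier over
  \<open>s\<close> and \<open>ys\<close> collapses to a single instance.\<close>

lemma takeWhile_eq_segment_iff:
  "w = s @ ys \<and> D \<notin> set s \<and> (ys = [] \<or> hd ys = D) \<longleftrightarrow>
     s = takeWhile (\<lambda>s. s \<noteq> D) w \<and> ys = dropWhile (\<lambda>s. s \<noteq> D) w"
proof
  assume *: "w = s @ ys \<and> D \<notin> set s \<and> (ys = [] \<or> hd ys = D)"
  then have "takeWhile (\<lambda>s. s \<noteq> D) ys = []" "dropWhile (\<lambda>s. s \<noteq> D) ys = ys"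
    by (cases ys; simp)+
  moreover have "takeWhile (\<lambda>s. s \<noteq> D) w = s @ takeWhile (\<lambda>s. s \<noteq> D) ys"
      "dropWhile (\<lambda>s. s \<noteq> D) w = dropWhile (\<lambda>s. s \<noteq> D) ys"
    using * takeWhile_append2[of s "\<lambda>s. s \<noteq> D" ys] dropWhile_append2[of s "\<lambda>s. s \<noteq> D" ys]
    by blast+
  ultimately show "s = takeWhile (\<lambda>s. s \<noteq> D) w \<and> ys = dropWhile (\<lambda>s. s \<noteq> D) w"
    by simp
next
  assume "s = takeWhile (\<lambda>s. s \<noteq> D) w \<and> ys = dropWhile (\<lambda>s. s \<noteq> D) w"
  then show "w = s @ ys \<and> D \<notin> set s \<and> (ys = [] \<or> hd ys = D)"
    using hd_dropWhile[of "\<lambda>s. s \<noteq> D" w] by (auto dest: set_takeWhileD)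
qed

text \<open>Here every stretch after a down-step is tested, including empty ones and the final one.
  This uniform condition matches the recursion without special cases; its agreement with the
  internal segments is a separate matter.\<close>

lemma segments_ok_iff:
  "segments_ok k c w \<longleftrightarrow> int k dvd c + horizontal_extent k (first_uh_segment w) \<and>
     (\<forall>xs s ys. w = xs @ D # s @ ys \<and> D \<notin> set s \<and> (ys = [] \<or> hd ys = D)
        \<longrightarrow> int k dvd horizontal_extent k s)"
    (is "_ \<longleftrightarrow> _ \<and> ?later w")
proof (induction w arbitrary: c)
  case Nil
  then show ?case by (simp add: first_uh_segment_def)
next
  case (Cons x w)
  have all_list: "(\<forall>xs. R xs) \<longleftrightarrow> R [] \<and> (\<forall>y ys. R (y # ys))" for R :: "step list \<Rightarrow> bool"
    by (metis list.exhaust)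
  have nD: "?later (x # w) \<longleftrightarrow> ?later w" if "x \<noteq> D"
    using that by (subst all_list) simp
  \<comment> \<open>An empty \<open>xs\<close> selects the stretch right after this down-step; a
    nonempty \<open>xs\<close> selects one further on in \<open>w\<close>.\<close>
  have later_D: "?later (D # w) \<longleftrightarrow> int k dvd horizontal_extent k (first_uh_segment w) \<and> ?later w"
  proof -
    have "?later (D # w) \<longleftrightarrow> (\<forall>s ys. w = s @ ys \<and> D \<notin> set s \<and> (ys = [] \<or> hd ys = D)
        \<longrightarrow> int k dvd horizontal_extent k s) \<and> ?later w"
      by (subst all_list) simp
    then show ?thesis
      unfolding takeWhile_eq_segment_iff first_uh_segment_def by simp
  qed
  show ?case
  proof (cases x)
    case U
    then show ?thesis using nD by (simp add: Cons.IH first_uh_segment_def add.assoc)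
  next
    case H
    have "int k dvd c + (int k + e) \<longleftrightarrow> int k dvd c + e" for e
      by (subst add.left_commute) simp
    then show ?thesis using nD H by (simp add: Cons.IH first_uh_segment_def)
  next
    case D
    show ?thesis unfolding D later_D by (simp add: Cons.IH first_uh_segment_def)
  qed
qed

lemma set_subset_UH_iff: "set s \<subseteq> {U, H} \<longleftrightarrow> D \<notin> set s"
  by (auto, metis step.exhaust)

text \<open>Beyond the internal segments, \<open>segments_ok\<close> tests only empty stretches and
  the final one. Neither contains an up- or down-step on a nonnegative path, so their lengths are
  multiples of \<open>k\<close> automatically.\<close>

lemma restricted_k_paths_eq:
  "restricted_k_paths r k l =
     {w. nonneg_path 0 w \<and> segments_ok k (- int l) w \<and>
         horizontal_extent k w = int (k * r + 2 * l)}"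
proof -
  have segments_iff: "(\<forall>xs s ys. w = xs @ s @ ys \<and> internal_uh_segment xs s ys
            \<longrightarrow> int k dvd horizontal_extent k s) \<longleftrightarrow>
        (\<forall>xs s ys. w = xs @ D # s @ ys \<and> D \<notin> set s \<and> (ys = [] \<or> hd ys = D)
            \<longrightarrow> int k dvd horizontal_extent k s)" (is "?int \<longleftrightarrow> ?later")
    if w: "nonneg_path 0 w" for w
  proof
    assume int: ?int
    show ?later
    proof (intro allI impI)
      fix xs s ys
      assume *: "w = xs @ D # s @ ys \<and> D \<notin> set s \<and> (ys = [] \<or> hd ys = D)"
      show "int k dvd horizontal_extent k s"
      proof (cases "s = [] \<or> ys = []")
        case True
        moreover have "U \<notin> set s" if "ys = []"
          using w * that nonneg_path_last_segment[of 0 "xs @ [D]" s] by simp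
        ultimately have "count_list s U = 0" "count_list s D = 0"
          using * by (auto simp: count_list_0_iff)
        then show ?thesis by (simp add: horizontal_extent_eq_count)
      next
        case False
        then have "w = (xs @ [D]) @ s @ ys" "internal_uh_segment (xs @ [D]) s ys"
          using * by (auto simp: internal_uh_segment_def uh_segment_def set_subset_UH_iff)
        then show ?thesis using int by blast
      qed
    qed
  next
    assume later: ?later
    show ?int
    proof (intro allI impI)
      fix xs s ys
      assume *: "w = xs @ s @ ys \<and> internal_uh_segment xs s ys"
      then have "xs = butlast xs @ [D]"
        by (auto simp: internal_uh_segment_def) (metis append_butlast_last_id)
      then have "w = butlast xs @ D # s @ ys"
        using * by (metis append.assoc append_Cons append_Nil)
      moreover have "D \<notin> set s" "ys = [] \<or> hd ys = D"
        using * by (auto simp: internal_uh_segment_def uh_segment_def set_subset_UH_iff)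
      ultimately show "int k dvd horizontal_extent k s"
        using later by blast
    qed
  qed
  have cong_iff: "[x = int l] (mod int k) \<longleftrightarrow> int k dvd - int l + x" for x
    by (simp add: cong_iff_dvd_diff)
  \<comment> \<open>The two segment conditions agree only on nonnegative paths, so the rearrangement
    must make \<open>A\<close> available as a hypothesis.\<close>
  have shape: "(A \<and> X) \<and> I \<and> C \<longleftrightarrow> A \<and> (C \<and> L) \<and> X" if "A \<Longrightarrow> I \<longleftrightarrow> L" for A X I C L
    using that by blast
  show ?thesis
    unfolding restricted_k_paths_def k_path_iff segments_ok_iff cong_iff
    by (intro Collect_cong shape segments_iff)
qed

section \<open>Paths without horizontal steps\<close>

definition expand :: "nat \<Rightarrow> bool list \<Rightarrow> step list" where
  "expand k bs = concat (map (\<lambda>b. if b then replicate k U else [D]) bs)"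

lemma expand_Nil [simp]: "expand k [] = []"
  and expand_True [simp]: "expand k (True # bs) = replicate k U @ expand k bs"
  and expand_False [simp]: "expand k (False # bs) = D # expand k bs"
  by (simp_all add: expand_def)

text \<open>With \<open>k\<close> positive a block begins with an up-step, so the first step of the
  expanded word reveals the first bit.\<close>

lemma inj_expand:
  assumes "k \<ge> 1"
  shows "inj (expand k)"
proof (rule injI)
  have first: "\<exists>w. replicate k U = U # w"
    using assms by (cases k) auto
  fix bs cs
  assume "expand k bs = expand k cs"
  then show "bs = cs"
  proof (induction bs arbitrary: cs)
    case Nil
    then show ?case using first by (cases cs rule: list.exhaust; cases "hd cs") auto
  next
    case (Cons b bs)
    then show ?case using first
      by (cases cs; cases b; cases "hd cs") auto
  qed
qed

lemma H_notin_expand: "H \<notin> set (expand k bs)"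
  by (auto simp: expand_def split: if_splits)

lemma count_expand_U: "count_list (expand k bs) U = k * count_list bs True"
proof (induction bs)
  case (Cons b bs)
  moreover have "count_list (replicate k U) U = k" by (induction k) auto
  ultimately show ?case by (cases b) auto
qed simp

lemma nonneg_path_replicate: "nonneg_path h (replicate j U @ w) \<longleftrightarrow> nonneg_path (h + j) w"
  by (induction j arbitrary: h) auto

lemma segments_ok_replicate: "segments_ok k c (replicate j U @ w) \<longleftrightarrow> segments_ok k (c + int j) w"
  by (induction j arbitrary: c) (auto simp: add.assoc)

lemma segments_ok_add_period: "segments_ok k (c + int k) w \<longleftrightarrow> segments_ok k c w"
  by (simp add: segments_ok_iff add.assoc add.left_commute[of c])

lemma segments_ok_expand: "segments_ok k 0 (expand k bs)"
proof (induction bs)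
  case (Cons b bs)
  then show ?case
    using segments_ok_add_period[of k 0] by (cases b) (auto simp: segments_ok_replicate)
qed simp

text \<open>A counter of -j means that j up-steps are still owed. Since \<open>j < k\<close>, a
  down-step or the end of the word is possible only when j = 0; an up-step read at that point opens
  a new block and leaves k - 1 owed.\<close>

lemma segments_ok_imp_expand:
  assumes "j < k" and "H \<notin> set v" and "segments_ok k (- int j) v"
  shows "\<exists>bs. v = replicate j U @ expand k bs"
  using assms
proof (induction v arbitrary: j)
  case Nil
  then have "j = 0" using nat_dvd_not_less[of j k] by auto
  then show ?case by (auto intro: exI[of _ "[]"])
next
  case (Cons x v)
  show ?case
  proof (cases x)
    case U
    show ?thesis
    proof (cases j)
      case 0
      \<comment> \<open>The counter is now 1, which is replaced by the congruent value 1 - k to fit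
        the induction hypothesis.\<close>
      have "segments_ok k (- int (k - 1)) v"
        using Cons.prems U 0 segments_ok_add_period[of k "- int (k - 1)" v]
        by (simp add: of_nat_diff)
      then obtain bs where "v = replicate (k - 1) U @ expand k bs"
        using Cons.IH[of "k - 1"] Cons.prems by auto
      then have "x # v = expand k (True # bs)"
        using U Cons.prems(1) by (cases k) auto
      then show ?thesis using 0 by (metis append_Nil replicate_0)
    next
      case (Suc i)
      then have "segments_ok k (- int i) v"
        using Cons.prems U by simp
      then show ?thesis using Cons.IH[of i] Cons.prems U Suc by auto
    qed
  next
    case D
    then have "int k dvd int j" "segments_ok k 0 v"
      using Cons.prems by auto
    then have "j = 0" using nat_dvd_not_less[of j k] Cons.prems(1) by auto
    moreover obtain bs where "v = expand k bs"
      using Cons.IH[of 0] Cons.prems \<open>segments_ok k 0 v\<close> by auto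
    ultimately have "x # v = replicate j U @ expand k (False # bs)"
      using D by simp
    then show ?thesis by blast
  qed (use Cons.prems in simp)
qed

section \<open>Counting block words by ballot numbers\<close>

definition block_paths :: "nat \<Rightarrow> nat \<Rightarrow> nat \<Rightarrow> bool list set" where
  "block_paths k h p = {bs. nonneg_path h (expand k bs) \<and> count_list bs True = p}"

lemma Nil_in_block_paths [simp]: "[] \<in> block_paths k h p \<longleftrightarrow> h = 0 \<and> p = 0"
  and True_in_block_paths [simp]:
    "True # bs \<in> block_paths k h p \<longleftrightarrow> p > 0 \<and> bs \<in> block_paths k (h + k) (p - 1)"
  and False_in_block_paths [simp]:
    "False # bs \<in> block_paths k h p \<longleftrightarrow> h > 0 \<and> bs \<in> block_paths k (h - 1) p"
  by (auto simp: block_paths_def nonneg_path_replicate)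

text \<open>Splitting by the first bit lets the membership rules for \<open>block_paths\<close>
  prove each recurrence directly.\<close>

lemma bool_list_set_eqI:
  assumes "[] \<in> A \<longleftrightarrow> [] \<in> B"
    and "\<And>bs. True # bs \<in> A \<longleftrightarrow> True # bs \<in> B"
    and "\<And>bs. False # bs \<in> A \<longleftrightarrow> False # bs \<in> B"
  shows "A = B"
proof (rule set_eqI)
  fix bs show "bs \<in> A \<longleftrightarrow> bs \<in> B"
    using assms by (cases bs; cases "hd bs") auto
qed

lemma block_paths_0_0: "block_paths k 0 0 = {[]}"
  by (rule bool_list_set_eqI) auto

lemma block_paths_Suc_0: "block_paths k (Suc h) 0 = Cons False ` block_paths k h 0"
  by (rule bool_list_set_eqI) auto

lemma block_paths_0_Suc: "block_paths k 0 (Suc p) = Cons True ` block_paths k k p"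
  by (rule bool_list_set_eqI) auto

lemma block_paths_Suc_Suc:
  "block_paths k (Suc h) (Suc p) =
     Cons True ` block_paths k (Suc h + k) p \<union> Cons False ` block_paths k h (Suc p)"
  by (rule bool_list_set_eqI) auto

lemma real_binomial_Suc_absorb:
  assumes "p < n"
  shows "real (Suc p) * real (n choose Suc p) = (real n - real p) * real (n choose p)"
proof -
  have "Suc p * (n choose Suc p) = (n - p) * (n choose p)"
    using binomial_absorption[of p n] binomial_absorb_comp[of n p] by simp
  then have "real (Suc p * (n choose Suc p)) = real ((n - p) * (n choose p))"
    by (rule arg_cong)
  then show ?thesis using assms by (simp add: of_nat_diff algebra_simps)
qed

text \<open>In this form the ballot numbers visibly inherit Pascal's rule.\<close>

lemma finite_and_card_block_paths:
  "finite (block_paths k h p) \<and>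
   (p = 0 \<longrightarrow> card (block_paths k h p) = 1) \<and>
   (\<forall>q. p = Suc q \<longrightarrow> real (card (block_paths k h p)) =
      real (((k + 1) * p + h) choose p) - real k * real (((k + 1) * p + h) choose q))"
proof (induction p arbitrary: h)
  case 0
  show ?case
    by (induction h) (simp_all add: block_paths_0_0 block_paths_Suc_0 card_image)
next
  case (Suc p)
  \<comment> \<open>This is the upper binomial index belonging to \<open>p\<close> blocks from
    height \<open>h + k\<close>, the situation after spending one block; with \<open>Suc p\<close>
    blocks from height \<open>h\<close> the index is one larger, as Pascal's rule requires.\<close>
  define n where "n h = (k + 1) * p + k + h" for h
  have top: "(k + 1) * Suc p + h = Suc (n h)" for h
    by (simp add: n_def)
  have IH: "real (card (block_paths k (h + k) p)) =
      real (n h choose p) - real k * (if p = 0 then 0 else real (n h choose (p - 1)))" for h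
    using Suc.IH[of "h + k"] by (cases p) (simp_all add: n_def algebra_simps)
  have fin: "finite (block_paths k (h + k) p)" for h
    using Suc.IH by blast
  have "finite (block_paths k h (Suc p)) \<and> real (card (block_paths k h (Suc p))) =
     real (Suc (n h) choose Suc p) - real k * real (Suc (n h) choose p)"
  proof (induction h)
    case 0
    have "card (block_paths k 0 (Suc p)) = card (block_paths k (0 + k) p)"
      by (simp add: block_paths_0_Suc card_image)
    \<comment> \<open>At height 0 only a block can come first, so the other half of Pascal's rule
      must vanish. It does because n 0 - p = k (p + 1).\<close>
    moreover have "real (n 0 choose Suc p) = real k * real (n 0 choose p)"
    proof (cases "k = 0")
      case False
      then have "real (Suc p) * real (n 0 choose Suc p) = real (Suc p) * (real k * real (n 0 choose p))"
        by (subst real_binomial_Suc_absorb) (auto simp: n_def algebra_simps)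
      then show ?thesis by (subst (asm) mult_cancel_left) simp
    qed (simp add: n_def)
    ultimately show ?case
      using fin[of 0] IH[of 0] by (cases p) (simp_all add: block_paths_0_Suc algebra_simps)
  next
    case (Suc h)
    have "card (block_paths k (Suc h) (Suc p)) =
        card (block_paths k (Suc h + k) p) + card (block_paths k h (Suc p))"
      unfolding block_paths_Suc_Suc using Suc fin[of "Suc h"]
      by (subst card_Un_disjoint) (auto simp: card_image)
    moreover have "n (Suc h) = Suc (n h)" by (simp add: n_def)
    ultimately show ?case
      using Suc fin[of "Suc h"] IH[of "Suc h"]
      by (cases p) (simp_all add: block_paths_Suc_Suc algebra_simps)
  qed
  then show ?case unfolding top by simp
qed

lemma finite_block_paths: "finite (block_paths k h p)"
  using finite_and_card_block_paths by blast

text \<open>With n = (k + 1) p + h, absorption turns C(n, p - 1) into p / (k p + h + 1) times C(n,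
  p). The difference C(n, p) - k C(n, p - 1) then has numerator (k p + h + 1) - k p = h + 1.\<close>

lemma card_block_paths:
  "real (card (block_paths k h p)) =
     real (h + 1) / real (k * p + h + 1) * real (((k + 1) * p + h) choose p)"
proof (cases p)
  case 0
  then show ?thesis using finite_and_card_block_paths[of k h p] by simp
next
  case (Suc q)
  define n where "n = (k + 1) * p + h"
  have absorb: "real p * real (n choose p) = real (k * p + h + 1) * real (n choose q)"
    unfolding Suc by (subst real_binomial_Suc_absorb) (auto simp: n_def Suc algebra_simps)
  have "real (card (block_paths k h p)) = real (n choose p) - real k * real (n choose q)"
    using finite_and_card_block_paths[of k h p] Suc unfolding n_def by blast
  then have "real (k * p + h + 1) * real (card (block_paths k h p)) =
      real (k * p + h + 1) * real (n choose p) - real k * (real (k * p + h + 1) * real (n choose q))"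
    by (simp only: right_diff_distrib mult.left_commute)
  also have "\<dots> = real (h + 1) * real (n choose p)"
    unfolding absorb[symmetric] by (simp add: algebra_simps)
  finally show ?thesis unfolding n_def
    by (simp add: field_simps del: of_nat_add of_nat_mult)
qed

section \<open>Inserting the horizontal steps\<close>

lemma nonneg_path_filter: "nonneg_path h (filter (\<lambda>s. s \<noteq> H) w) \<longleftrightarrow> nonneg_path h w"
  by (induction h w rule: nonneg_path.induct) auto

lemma segments_ok_filter: "segments_ok k c (filter (\<lambda>s. s \<noteq> H) w) \<longleftrightarrow> segments_ok k c w"
  by (induction k c w rule: segments_ok.induct) auto

lemma count_list_filter: "count_list (filter P w) s = (if P s then count_list w s else 0)"
  by (induction w) auto

text \<open>As \<open>v\<close> is free of \<open>H\<close>, deleting the horizontal steps recovers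
  it, and only their number remains to be recorded.\<close>

lemma shuffles_replicate_H_iff:
  assumes "H \<notin> set v"
  shows "w \<in> shuffles v (replicate q H) \<longleftrightarrow>
    filter (\<lambda>s. s \<noteq> H) w = v \<and> count_list w H = q"
proof
  assume w: "w \<in> shuffles v (replicate q H)"
  have "filter (\<lambda>s. s \<noteq> H) w \<in> filter (\<lambda>s. s \<noteq> H) ` shuffles v (replicate q H)"
    using w by blast
  then have "filter (\<lambda>s. s \<noteq> H) w \<in> shuffles v []"
    using assms by (simp add: filter_shuffles filter_id_conv) (metis filter_True)
  moreover have "length w = length v + q"
    using w length_shuffles by fastforce
  moreover have "length w = length (filter (\<lambda>s. s \<noteq> H) w) + count_list w H"
    by (induction w) auto
  ultimately show "filter (\<lambda>s. s \<noteq> H) w = v \<and> count_list w H = q"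
    by simp
next
  assume *: "filter (\<lambda>s. s \<noteq> H) w = v \<and> count_list w H = q"
  have "filter (\<lambda>s. \<not> s \<noteq> H) w = replicate (count_list w H) H"
    by (induction w) auto
  then show "w \<in> shuffles v (replicate q H)"
    using partition_in_shuffles[of w "\<lambda>s. s \<noteq> H"] * by simp
qed

lemma card_shuffles_replicate_H:
  assumes "H \<notin> set v"
  shows "card (shuffles v (replicate q H)) = (length v + q) choose q"
proof -
  have "set v \<inter> set (replicate q H) = {}"
    using assms by auto
  then have "card (shuffles v (replicate q H)) = (length v + q) choose length v"
    by (subst card_disjoint_shuffles) simp_all
  then show ?thesis
    using binomial_symmetric[of q "length v + q"] by simp
qed

section \<open>Decomposition and total count\<close>

lemma length_eq_counts:
  "length w = count_list w U + count_list w D + count_list w H"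
proof (induction w)
  case (Cons s w)
  then show ?case by (cases s) auto
qed simp

text \<open>The forced prefix of \<open>l\<close> up-steps lifts the path to height
  \<open>l\<close>, where a block word with \<open>p\<close> blocks takes over. Up- and down-steps
  contribute 2 (k p + l) to the length, so the prescribed total leaves exactly r - 2 p horizontal
  steps.\<close>

lemma restricted_k_paths_decomposition:
  assumes "l < k"
  shows "restricted_k_paths r k l =
    (\<Union>(p, bs)\<in>(SIGMA p:{0..r div 2}. block_paths k l p).
       shuffles (replicate l U @ expand k bs) (replicate (r - 2 * p) H))"
proof (rule set_eqI, rule iffI)
  have counts: "horizontal_extent k w = int (k * (2 * p + count_list w H) + 2 * l)"
    if "nonneg_path 0 w" "filter (\<lambda>s. s \<noteq> H) w = replicate l U @ expand k bs"
      "count_list bs True = p" for w bs p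
  proof -
    have "count_list w U = count_list (filter (\<lambda>s. s \<noteq> H) w) U"
      by (simp add: count_list_filter)
    moreover have "count_list (replicate l U) U = l" by (induction l) auto
    ultimately have "count_list w U = l + k * p"
      using that by (simp add: count_expand_U)
    moreover have "count_list w D = count_list w U"
      using nonneg_path_count[OF that(1)] by simp
    ultimately show ?thesis
      by (simp add: horizontal_extent_eq_count algebra_simps)
  qed
  {
    fix w assume "w \<in> restricted_k_paths r k l"
    then have w: "nonneg_path 0 w" "segments_ok k (- int l) w"
        "horizontal_extent k w = int (k * r + 2 * l)"
      by (auto simp: restricted_k_paths_eq)
    then obtain bs where bs: "filter (\<lambda>s. s \<noteq> H) w = replicate l U @ expand k bs"
      using segments_ok_imp_expand[OF assms, of "filter (\<lambda>s. s \<noteq> H) w"]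
      by (auto simp: segments_ok_filter)
    define p where "p = count_list bs True"
    have "int (k * (2 * p + count_list w H) + 2 * l) = int (k * r + 2 * l)"
      using counts[OF w(1) bs p_def[symmetric]] w(3) by (rule trans[OF sym])
    then have "k * (2 * p + count_list w H) = k * r"
      unfolding of_nat_eq_iff by linarith
    then have r: "2 * p + count_list w H = r"
      using assms by simp
    then have "w \<in> shuffles (replicate l U @ expand k bs) (replicate (r - 2 * p) H)"
      using bs by (subst shuffles_replicate_H_iff) (auto simp: H_notin_expand)
    moreover have "nonneg_path 0 (replicate l U @ expand k bs)"
      using w(1) nonneg_path_filter[of 0 w] bs by simp
    then have "bs \<in> block_paths k l p"
      by (simp add: block_paths_def p_def nonneg_path_replicate)
    then have "(p, bs) \<in> (SIGMA p:{0..r div 2}. block_paths k l p)"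
      using r by simp
    ultimately show "w \<in> (\<Union>(p, bs)\<in>(SIGMA p:{0..r div 2}. block_paths k l p).
        shuffles (replicate l U @ expand k bs) (replicate (r - 2 * p) H))"
      by (intro UN_I[where a = "(p, bs)"]) simp_all
  }
  {
    fix w assume "w \<in> (\<Union>(p, bs)\<in>(SIGMA p:{0..r div 2}. block_paths k l p).
        shuffles (replicate l U @ expand k bs) (replicate (r - 2 * p) H))"
    then obtain p bs where p: "p \<le> r div 2" and bs: "bs \<in> block_paths k l p"
      and w: "w \<in> shuffles (replicate l U @ expand k bs) (replicate (r - 2 * p) H)"
      by auto
    have "H \<notin> set (replicate l U @ expand k bs)"
      by (auto simp: H_notin_expand)
    from w[unfolded shuffles_replicate_H_iff[OF this]]
    have w: "filter (\<lambda>s. s \<noteq> H) w = replicate l U @ expand k bs" "count_list w H = r - 2 * p"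
      by simp_all
    have "nonneg_path 0 w"
      using bs nonneg_path_filter[of 0 w] w(1) by (simp add: block_paths_def nonneg_path_replicate)
    moreover have "segments_ok k (- int l) w"
      using segments_ok_filter[of k "- int l" w] w(1)
      by (simp add: segments_ok_replicate segments_ok_expand)
    moreover have "horizontal_extent k w = int (k * r + 2 * l)"
      using counts[OF \<open>nonneg_path 0 w\<close> w(1)] bs w(2) p by (simp add: block_paths_def)
    ultimately show "w \<in> restricted_k_paths r k l"
      by (simp add: restricted_k_paths_eq)
  }
qed

lemma card_restricted_k_paths:
  assumes "l < k"
  shows "card (restricted_k_paths r k l) =
    (\<Sum>p = 0..r div 2. card (block_paths k l p) *
       ((r + 2 * (k - 1) * p + 2 * l) choose (r - 2 * p)))"
proof -
  let ?S = "SIGMA p:{0..r div 2}. block_paths k l p"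
  let ?v = "\<lambda>bs. replicate l U @ expand k bs"
  let ?A = "\<lambda>(p, bs). shuffles (?v bs) (replicate (r - 2 * p) H)"
  have H: "H \<notin> set (?v bs)" for bs
    by (auto simp: H_notin_expand)
  \<comment> \<open>A common path yields the same word after deleting \<open>H\<close>, hence the
    same bits by injectivity of \<open>expand\<close>, and \<open>p\<close> is the number of
    \<open>True\<close> bits.\<close>
  have "?A x \<inter> ?A y = {}" if "x \<in> ?S" "y \<in> ?S" "x \<noteq> y" for x y
  proof (rule ccontr)
    obtain p bs q cs where xy: "x = (p, bs)" "y = (q, cs)" by (cases x, cases y)
    assume "?A x \<inter> ?A y \<noteq> {}"
    then have "?v bs = ?v cs"
      unfolding xy by (auto simp: shuffles_replicate_H_iff[OF H])
    then have "bs = cs"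
      using inj_expand[of k] assms by (auto dest: injD)
    then show False
      using that unfolding xy by (auto simp: block_paths_def)
  qed
  then have "card (\<Union>x\<in>?S. ?A x) = (\<Sum>x\<in>?S. card (?A x))"
    by (intro card_UN_disjoint) (auto simp: finite_block_paths)
  also have "\<dots> = (\<Sum>x\<in>?S. (\<lambda>(p, bs). (r + 2 * (k - 1) * p + 2 * l) choose (r - 2 * p)) x)"
  proof (rule sum.cong[OF refl], clarify)
    fix p bs
    assume p: "p \<in> {0..r div 2}" and bs: "bs \<in> block_paths k l p"
    have path: "nonneg_path l (expand k bs)" and count: "count_list bs True = p"
      using bs by (auto simp: block_paths_def)
    have "count_list (expand k bs) H = 0"
      using H_notin_expand by (simp add: count_list_0_iff)
    then have "length (?v bs) = 2 * (k * p + l)"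
      using nonneg_path_count[OF path] length_eq_counts[of "expand k bs"]
      by (simp add: count_expand_U count)
    \<comment> \<open>Both truncated subtractions are genuine: 2 p is at most r, and
      \<open>k\<close> is positive.\<close>
    moreover have "2 * (k * p + l) + (r - 2 * p) = r + 2 * (k - 1) * p + 2 * l"
    proof -
      obtain j where "k = Suc j" using assms by (cases k) auto
      then show ?thesis using p by (simp add: algebra_simps)
    qed
    ultimately show "card (shuffles (?v bs) (replicate (r - 2 * p) H)) =
        (r + 2 * (k - 1) * p + 2 * l) choose (r - 2 * p)"
      by (simp only: card_shuffles_replicate_H[OF H])
  qed
  also have "\<dots> = (\<Sum>p = 0..r div 2. \<Sum>bs\<in>block_paths k l p.
      (r + 2 * (k - 1) * p + 2 * l) choose (r - 2 * p))"
    by (subst sum.Sigma) (auto simp: finite_block_paths split_def)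
  finally show ?thesis
    using restricted_k_paths_decomposition[OF assms, of r] by simp
qed

theorem theorem5p1:
  fixes k l r :: nat
  assumes "k \<ge> 1" and "l \<le> k - 1"
  shows "real (card (restricted_k_paths r k l)) =
    (\<Sum>p = 0..r div 2.
       real (l + 1) / real (k * p + l + 1)
       * real (((k + 1) * p + l) choose p)
       * real ((r + 2 * (k - 1) * p + 2 * l) choose (r - 2 * p)))"
proof -
  have "l < k" using assms by simp
  show ?thesis
    unfolding card_restricted_k_paths[OF \<open>l < k\<close>] of_nat_sum of_nat_mult card_block_paths[symmetric]
    by (rule refl)
qed

end
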